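(* Let $\mathcal{P}$ be the set of integer partitions that satisfy Condition($1$) and in which $2$ does not appear as a part. Then, as formal power series in $x,q$, writing $N=i+2j+3k$, $$\sum_{\pi\in\mathcal{P}}x^{\ell(\pi)}q^{|\pi|}=\sum_{i,j,k\ge 0}\frac{x^{N+1}q^{\frac{(N+1)N}{2}+2i+j^2+2j+4k+1}+x^{N+2}q^{\frac{(N+2)(N+1)}{2}+i+j^2+2j+4k+1}+x^{N}q^{\frac{N(N-1)}{2}+3i+j^2+4j+7k}}{(q;q)_i\,(q^2;q^2)_j\,(q^3;q^3)_k}.$$
   Context: Partitions are finite weakly increasing sequences of positive integers (the empty partition is included); $\ell(\pi)$ is the number of parts and $|\pi|$ the sum of the parts of $\pi$. For a fixed integer $c$, a partition $\pi=\lambda_1+\lambda_2+\cdots+\lambda_m$ with $\lambda_1\le\lambda_2\le\cdots\le\lambda_m$ satisfies Condition($c$) if $\lambda_{s+3}-\lambda_s\ge 3$ for all $1\le s\le m-3$, and, for all $1\le s\le m-2$, if $\lambda_{s+2}-\lambda_s\le 1$ then $\lambda_s+\lambda_{s+1}+\lambda_{s+2}\equiv c\pmod 3$. For $n\ge 0$, $(a;q)_n=\prod_{0\le t<n}(1-aq^t)$. All identities are identities of formal power series. *)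

theory Defs
  imports
    "HOL-Analysis.Infinite_Sum"
    "HOL-Computational_Algebra.Formal_Power_Series"
    "HOL-Number_Theory.Cong"
begin

definition is_partition :: "nat list \<Rightarrow> bool" where
  "is_partition p \<longleftrightarrow> sorted p \<and> (\<forall>a\<in>set p. a > 0)"

text \<open>
  List indices start at 0, so the list entry at index s is the part with (1-based) number s + 1.
\<close>

definition condition :: "int \<Rightarrow> nat list \<Rightarrow> bool" where
  "condition c p \<longleftrightarrow>
     (\<forall>s. s + 3 < length p \<longrightarrow> int (p ! (s + 3)) - int (p ! s) \<ge> 3) \<and>
     (\<forall>s. s + 2 < length p \<longrightarrow> int (p ! (s + 2)) - int (p ! s) \<le> 1 \<longrightarrow>
        [int (p ! s) + int (p ! (s + 1)) + int (p ! (s + 2)) = c] (mod 3))"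

text \<open>
  Power series in x and q are represented as power series in q whose coefficients are power
  series in x. The library metric on the outer type is the q-adic one. Its topology is finer
  than that of coefficientwise convergence in both variables, and it is Hausdorff, so a sum that
  exists here agrees with the usual formal sum. With the roles of x and q exchanged, the sum over
  partitions would not converge: there are infinitely many partitions of a given length.
\<close>

type_synonym series_xq = "rat fps fps"

definition var_q :: series_xq where "var_q = fps_X"

definition var_x :: series_xq where "var_x = fps_const fps_X"

definition qpoch :: "'a::comm_ring_1 \<Rightarrow> 'a \<Rightarrow> nat \<Rightarrow> 'a" where
  "qpoch a q n = (\<Prod>t<n. 1 - a * q ^ t)"

text \<open>
  The coefficients form a ring but not a field, so the library facts about division of power
  series over a division ring do not apply to the type above. The next facts show that
  division by a product of q-Pochhammer symbols is nevertheless genuine division.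
\<close>

lemma series_xq_divide_mult_cancel:
  fixes f d :: series_xq
  assumes "fps_nth d 0 = 1"
  shows "f / d * d = f"
proof -
  have one: "inverse (1 :: rat fps) = 1" by simp
  have sd: "subdegree d = 0"
    using assms by (simp add: subdegree_eq_0_iff)
  have "inverse d = fps_right_inverse d 1"
    using fps_inverse_def[of d] by (simp only: assms one)
  then have "d * inverse d = 1"
    using fps_right_inverse[of d 1] assms by simp
  moreover have "f / d = f * inverse d"
    by (simp add: fps_divide_def sd)
  ultimately show ?thesis
    by (simp add: mult.assoc mult.commute[of _ d])
qed

lemma qpoch_var_q_nth_0:
  assumes "m > 0"
  shows "fps_nth (qpoch (var_q ^ m) (var_q ^ m) n) 0 = 1"
  using assms unfolding qpoch_def var_q_def
  by (induction n) (simp_all add: fps_mult_nth_0 flip: power_mult power_add)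

end

theory Submission
  imports Defs
begin

text \<open>
  In terms of the multiplicities of \<open>1, 2, 3, \<dots>\<close>, Condition(1) forbids the patterns
  12, 22, 211 and 202; in particular it is invariant under shifting all parts by one. Let \<open>A(x)\<close> be
  the generating function of all partitions satisfying it, and \<open>B(x)\<close> that of those in which the
  part 1 occurs at most once. Splitting off the smallest parts gives
  \<open>B(x) = A(xq) + xq B(xq)\<close> and
  \<open>A(x) = B(x) + x\<^sup>2q\<^sup>2 B(xq\<^sup>2) + x\<^sup>3q\<^sup>4 A(xq\<^sup>3)\<close>, and the generating function of \<open>P\<close> is
  \<open>(1 + xq) A(xq\<^sup>2) + x\<^sup>2q\<^sup>2 B(xq\<^sup>2)\<close>. With \<open>A(0) = 1\<close> the system determines \<open>A\<close> and \<open>B\<close>, as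
  comparison of the coefficients of \<open>x\<^sup>m\<close> shows.

  For the triple sum \<open>H a b c\<close> of
  \<open>x\<^sup>N q\<close> to the power \<open>N(N-1)/2 + j\<^sup>2 + ai + bj + ck\<close> over
  \<open>(q;q)\<^sub>i (q\<^sup>2;q\<^sup>2)\<^sub>j (q\<^sup>3;q\<^sup>3)\<^sub>k\<close>, cancelling the last factor of one of the three Pochhammer
  symbols gives a contiguous relation in \<open>a\<close>, \<open>b\<close> or \<open>c\<close>. By these relations \<open>A = H 1 0 1\<close>,
  \<open>B = H 1 2 4\<close> solves the system, and the right-hand side of the theorem is
  \<open>(1 + xq) H 3 4 7 + x\<^sup>2q\<^sup>2 H 3 6 10\<close>. Below, \<open>H a b c m\<close> is the coefficient of \<open>x\<^sup>m\<close>, a series in \<open>q\<close>.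
\<close>

subsection \<open>The shape of the partitions\<close>

definition good :: "nat list \<Rightarrow> bool" where
  "good p \<longleftrightarrow> is_partition p \<and> condition 1 p"

text \<open>For good partitions: the part 1 occurs at most once.\<close>
definition sparse :: "nat list \<Rightarrow> bool" where
  "sparse p \<longleftrightarrow> (length p \<ge> 2 \<longrightarrow> p ! 1 \<ge> 2)"

lemma sparse_simps [simp]: "sparse []" "sparse [a]" "sparse (a # b # p) \<longleftrightarrow> b \<ge> 2"
  by (simp_all add: sparse_def)

lemma is_partition_Cons:
  "is_partition (a # p) \<longleftrightarrow> a > 0 \<and> (\<forall>x\<in>set p. a \<le> x) \<and> is_partition p"
  by (auto simp: is_partition_def)

lemma all_nat_split: "(\<forall>n::nat. P n) \<longleftrightarrow> P 0 \<and> (\<forall>n. P (Suc n))"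
  by (metis nat.exhaust)

text \<open>Only the windows that begin at the new part are new; every other window of
  \<open>a # p\<close> is a window of \<open>p\<close>.\<close>

lemma condition_Cons:
  "condition c (a # p) \<longleftrightarrow> condition c p \<and>
     (3 \<le> length p \<longrightarrow> int (p ! 2) - int a \<ge> 3) \<and>
     (2 \<le> length p \<longrightarrow> int (p ! 1) - int a \<le> 1 \<longrightarrow>
        [int a + int (p ! 0) + int (p ! 1) = c] (mod 3))"
proof -
  have "(\<forall>s. s + 3 < length (a # p) \<longrightarrow> int ((a # p) ! (s + 3)) - int ((a # p) ! s) \<ge> 3) \<longleftrightarrow>
      (3 \<le> length p \<longrightarrow> int (p ! 2) - int a \<ge> 3) \<and>
      (\<forall>s. s + 3 < length p \<longrightarrow> int (p ! (s + 3)) - int (p ! s) \<ge> 3)"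
    by (subst all_nat_split) (simp add: numeral_3_eq_3 numeral_2_eq_2 less_eq_Suc_le)
  moreover have "(\<forall>s. s + 2 < length (a # p) \<longrightarrow> int ((a # p) ! (s + 2)) - int ((a # p) ! s) \<le> 1 \<longrightarrow>
        [int ((a # p) ! s) + int ((a # p) ! (s + 1)) + int ((a # p) ! (s + 2)) = c] (mod 3)) \<longleftrightarrow>
      (2 \<le> length p \<longrightarrow> int (p ! 1) - int a \<le> 1 \<longrightarrow>
        [int a + int (p ! 0) + int (p ! 1) = c] (mod 3)) \<and>
      (\<forall>s. s + 2 < length p \<longrightarrow> int (p ! (s + 2)) - int (p ! s) \<le> 1 \<longrightarrow>
        [int (p ! s) + int (p ! (s + 1)) + int (p ! (s + 2)) = c] (mod 3))"
    by (subst all_nat_split) (simp add: numeral_2_eq_2 less_eq_Suc_le)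
  ultimately show ?thesis
    unfolding condition_def by blast
qed

lemma good_Nil [simp]: "good []"
  by (simp add: good_def is_partition_def condition_def)

lemma good_Cons [simp]:
  "good (a # p) \<longleftrightarrow> good p \<and> a > 0 \<and> (\<forall>x\<in>set p. a \<le> x) \<and>
     (3 \<le> length p \<longrightarrow> a + 3 \<le> p ! 2) \<and>
     (2 \<le> length p \<longrightarrow> p ! 1 \<le> a + 1 \<longrightarrow> (a + p ! 0 + p ! 1) mod 3 = 1)"
proof -
  have "[int a + int (p ! 0) + int (p ! 1) = 1] (mod 3) \<longleftrightarrow> (a + p ! 0 + p ! 1) mod 3 = 1"
    using cong_int_iff[of "a + p ! 0 + p ! 1" 1 3] by (simp add: cong_def)
  moreover have "int (p ! 2) - int a \<ge> 3 \<longleftrightarrow> a + 3 \<le> p ! 2" "int (p ! 1) - int a \<le> 1 \<longleftrightarrow> p ! 1 \<le> a + 1"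
    by linarith+
  ultimately show ?thesis
    by (auto simp: good_def is_partition_Cons condition_Cons)
qed

text \<open>Differences of parts do not change, and a sum of three parts grows by
  \<open>3 * k\<close>, which keeps its residue modulo 3.\<close>

lemma good_shift_iff:
  assumes "\<forall>x\<in>set p. x > 0"
  shows "good (map (\<lambda>x. x + k) p) \<longleftrightarrow> good p"
  using assms
proof (induction p)
  case (Cons a p)
  have "(a + k + (x + k) + (y + k)) mod 3 = 1 \<longleftrightarrow> (a + x + y) mod 3 = 1" for x y
  proof -
    have "a + k + (x + k) + (y + k) = a + x + y + 3 * k"
      by simp
    then show ?thesis
      by (metis mod_mult_self2)
  qed
  moreover have "map (\<lambda>x. x + k) p ! 0 = p ! 0 + k" if "2 \<le> length p"
    using that by (subst nth_map) auto
  ultimately show ?case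
    using Cons by auto
qed simp

lemma good_parts_pos: "good p \<Longrightarrow> x \<in> set p \<Longrightarrow> x > 0"
  by (induction p) auto

lemma good_unshift:
  assumes "good p" "p = [] \<or> hd p > k"
  obtains r where "good r" "p = map (\<lambda>x. x + k) r"
proof -
  have gt: "\<forall>x\<in>set p. x > k"
    using assms by (cases p) auto
  define r where "r = map (\<lambda>x. x - k) p"
  have "p = map (\<lambda>x. x + k) r"
    using gt by (auto simp: r_def intro!: map_idI[symmetric])
  moreover have "\<forall>x\<in>set r. x > 0"
    using gt by (auto simp: r_def)
  ultimately show thesis
    using that assms(1) good_shift_iff by metis
qed

section \<open>Which small parts may precede a shifted partition\<close>

lemma sparse_third:
  assumes "good (a # b # c # s)" "b \<ge> 2"
  shows "c \<ge> 3"
proof (rule ccontr)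
  assume "\<not> c \<ge> 3"
  moreover have "0 < a" "a \<le> b" "b \<le> c"
    using assms(1) by simp_all
  ultimately have "b = 2" "c = 2" "a = 1 \<or> a = 2"
    using assms(2) by linarith+
  \<comment> \<open>The triples 1, 2, 2 and 2, 2, 2 have sums congruent to 2 and 0 modulo 3.\<close>
  then show False
    using assms(1) by (elim disjE) simp_all
qed

lemma good_shift: "good p \<Longrightarrow> good (map (\<lambda>x. x + k) p)"
  using good_shift_iff good_parts_pos by blast

text \<open>The residue condition on 1, \<open>a + 1\<close>, \<open>b + 1\<close> can only be
  violated by 1, 2, 2, and sparsity excludes exactly this triple. It also yields the distance to the
  fourth part, by \<open>sparse_third\<close>.\<close>

lemma good_1_iff:
  assumes "good r"
  shows "good (1 # map (\<lambda>x. x + 1) r) \<longleftrightarrow> sparse r"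
proof (cases r rule: remdups_adj.cases)
  case (3 a b s)
  have g: "good (map (\<lambda>x. x + 1) r)"
    using assms by (rule good_shift)
  have "2 < b + 1" if "b + 1 \<le> 2 \<longrightarrow> (1 + (a + 1) + (b + 1)) mod 3 = 1"
  proof (rule ccontr)
    assume "\<not> 2 < b + 1"
    then have "a = 1" "b = 1"
      using assms 3 by auto
    then show False
      using that by simp
  qed
  moreover have "s ! 0 \<ge> 3" if "b \<ge> 2" "s \<noteq> []"
    using that sparse_third[of a b "s ! 0" "tl s"] assms 3 by (cases s) auto
  ultimately show ?thesis
    using g unfolding 3 good_Cons[of 1] by (auto simp del: good_Cons simp: Suc_le_eq)
qed (use assms in auto)

text \<open>Three ones have sum 3, which is 0 modulo 3.\<close>

lemma third_ge_2: "good (a # b # c # s) \<Longrightarrow> c \<ge> 2"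
proof (rule ccontr)
  assume good: "good (a # b # c # s)" and "\<not> c \<ge> 2"
  then have "a = 1" "b = 1" "c = 1"
    by auto
  then show False
    using good by simp
qed

text \<open>The triple 1, \<open>a + 2\<close>, \<open>b + 2\<close> spans at least 2, so it carries
  no residue condition, and \<open>third_ge_2\<close> makes the fourth part at least 4.\<close>

lemma good_1_shift_2:
  assumes "good r"
  shows "good (1 # map (\<lambda>x. x + 2) r)"
proof (cases r rule: remdups_adj.cases)
  case (3 a b s)
  have "s ! 0 \<ge> 2" if "s \<noteq> []"
    using that third_ge_2[of a b "s ! 0" "tl s"] assms 3 by (cases s) auto
  then show ?thesis
    using good_shift[OF assms, of 2] good_parts_pos[OF assms]
    unfolding 3 good_Cons[of 1] by (auto simp del: good_Cons simp: Suc_le_eq)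
qed (use assms in auto)

text \<open>The part after the two ones is at least 3, so no residue condition arises. The fourth
  part \<open>b + 2\<close> has to reach 4, and this is sparsity of \<open>r\<close>.\<close>

lemma good_1_1_iff:
  assumes "good r"
  shows "good (1 # 1 # map (\<lambda>x. x + 2) r) \<longleftrightarrow> sparse r"
proof (cases r rule: remdups_adj.cases)
  case (3 a b s)
  show ?thesis
    using good_1_shift_2[OF assms] good_parts_pos[OF assms]
    unfolding 3 good_Cons[of _ "1 # _"] by (auto simp del: good_Cons)
qed (use assms in auto)

text \<open>The triple 1, 1, 2 has the permitted sum 4. The shift by 3 keeps all later parts at
  least 4, and the distance condition starting at the part 2 follows from
  \<open>third_ge_2\<close>.\<close>

lemma good_1_1_2:
  assumes "good r"
  shows "good (1 # 1 # 2 # map (\<lambda>x. x + 3) r)"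
proof (cases r rule: remdups_adj.cases)
  case (3 a b s)
  have "s ! 0 \<ge> 2" if "s \<noteq> []"
    using that third_ge_2[of a b "s ! 0" "tl s"] assms 3 by (cases s) auto
  then have "good (2 # map (\<lambda>x. x + 3) r)"
    using good_shift[OF assms, of 3] good_parts_pos[OF assms]
    unfolding 3 good_Cons[of 2] by (auto simp del: good_Cons simp: Suc_le_eq)
  then show ?thesis
    using good_parts_pos[OF assms]
    unfolding 3 good_Cons[of _ "1 # _"] good_Cons[of _ "2 # _"]
    by (auto simp del: good_Cons simp: Suc_le_eq)
qed (use assms in auto)

section \<open>Decompositions according to the smallest parts\<close>

lemma sparse_decomp:
  "{p. good p \<and> sparse p} =
     map (\<lambda>x. x + 1) ` {p. good p} \<union> (\<lambda>r. 1 # map (\<lambda>x. x + 1) r) ` {p. good p \<and> sparse p}"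
  (is "?L = ?R")
proof (intro subset_antisym subsetI)
  fix p assume "p \<in> ?L"
  then have p: "good p" "sparse p"
    by auto
  show "p \<in> ?R"
  proof (cases "p = [] \<or> hd p > 1")
    case True
    with p(1) obtain r where "good r" "p = map (\<lambda>x. x + 1) r"
      by (rule good_unshift)
    then show ?thesis
      by blast
  next
    case False
    then obtain t where t: "p = 1 # t"
      using p by (cases p) (auto simp: not_less le_Suc_eq)
    \<comment> \<open>Sparsity says that no second 1 follows.\<close>
    have "good t" "t = [] \<or> hd t > 1"
      using p unfolding t by (cases t; simp)+
    then obtain r where r: "good r" "t = map (\<lambda>x. x + 1) r"
      by (rule good_unshift)
    then have "sparse r"
      using p good_1_iff[of r] unfolding t by blast
    then show ?thesis
      using r unfolding t by blast
  qed
next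
  fix p assume "p \<in> ?R"
  then consider r where "good r" "p = map (\<lambda>x. x + 1) r"
    | r where "good r" "sparse r" "p = 1 # map (\<lambda>x. x + 1) r"
    by auto
  then show "p \<in> ?L"
  proof cases
    case (1 r)
    have "sparse p"
      using good_parts_pos[OF 1(1)] unfolding 1(2) by (cases r rule: remdups_adj.cases) (auto simp: Suc_le_eq)
    then show ?thesis
      using good_shift[OF 1(1)] unfolding 1(2) by blast
  next
    case (2 r)
    have "sparse p"
      using good_parts_pos[OF 2(1)] unfolding 2(3) by (cases r) (auto simp: Suc_le_eq)
    then show ?thesis
      using good_1_iff[OF 2(1)] 2 by blast
  qed
qed

text \<open>A partition that is not sparse begins with 1, 1. By \<open>third_ge_2\<close> its third
  part is either 2 or larger, which gives the last two pieces.\<close>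

lemma good_decomp:
  "{p. good p} = {p. good p \<and> sparse p} \<union>
     (\<lambda>r. 1 # 1 # map (\<lambda>x. x + 2) r) ` {p. good p \<and> sparse p} \<union>
     (\<lambda>r. 1 # 1 # 2 # map (\<lambda>x. x + 3) r) ` {p. good p}"
  (is "?L = ?R")
proof (intro subset_antisym subsetI)
  fix p assume "p \<in> ?L"
  then have p: "good p"
    by simp
  show "p \<in> ?R"
  proof (cases "sparse p")
    case False
    then obtain t where t: "p = 1 # 1 # t"
      using p by (cases p rule: remdups_adj.cases) (auto simp: not_le less_Suc_eq numeral_2_eq_2)
    have good_t: "good t"
      using p t by simp
    show ?thesis
    proof (cases "t = [] \<or> hd t > 2")
      case True
      with good_t obtain r where r: "good r" "t = map (\<lambda>x. x + 2) r"
        by (rule good_unshift)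
      then have "sparse r"
        using p good_1_1_iff[of r] unfolding t by blast
      then show ?thesis
        using r unfolding t by blast
    next
      case False
      then obtain c u where cu: "t = c # u" "c \<le> 2"
        by (cases t) (auto simp: not_less)
      moreover have "c \<ge> 2"
        using p third_ge_2 unfolding t cu by blast
      ultimately have u: "t = 2 # u"
        by simp
      \<comment> \<open>The part after 1, 1, 2 is the fourth one, hence at least 3 above the first
        1.\<close>
      have "good u" "u = [] \<or> hd u > 3"
        using p unfolding t u by (cases u; simp)+
      then obtain r where "good r" "u = map (\<lambda>x. x + 3) r"
        by (rule good_unshift)
      then show ?thesis
        unfolding t u by blast
    qed
  qed (use p in auto)
qed (use good_1_1_iff good_1_1_2 in blast)

text \<open>The three pieces are distinguished by the number of ones, which is at most two; all
  remaining parts are at least 3.\<close>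

lemma without_2_decomp:
  "{p. good p \<and> 2 \<notin> set p} = map (\<lambda>x. x + 2) ` {p. good p} \<union>
     (\<lambda>r. 1 # map (\<lambda>x. x + 2) r) ` {p. good p} \<union>
     (\<lambda>r. 1 # 1 # map (\<lambda>x. x + 2) r) ` {p. good p \<and> sparse p}"
  (is "?L = ?R")
proof (intro subset_antisym subsetI)
  fix p assume "p \<in> ?L"
  then have p: "good p" "2 \<notin> set p"
    by auto
  show "p \<in> ?R"
  proof (cases "p = [] \<or> hd p > 2")
    case True
    with p(1) obtain r where "good r" "p = map (\<lambda>x. x + 2) r"
      by (rule good_unshift)
    then show ?thesis
      by blast
  next
    case False
    then obtain t where t: "p = 1 # t"
      using p by (cases p) (auto simp: not_less le_Suc_eq numeral_2_eq_2)
    have good_t: "good t"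
      using p t by simp
    show ?thesis
    proof (cases "t = [] \<or> hd t > 2")
      case True
      with good_t obtain r where "good r" "t = map (\<lambda>x. x + 2) r"
        by (rule good_unshift)
      then show ?thesis
        unfolding t by blast
    next
      case False
      then obtain u where u: "t = 1 # u"
        using p t by (cases t) (auto simp: not_less le_Suc_eq numeral_2_eq_2)
      have "u = [] \<or> hd u > 2"
      proof (cases u)
        case (Cons c v)
        have "c \<ge> 2"
          using p(1) third_ge_2 unfolding t u Cons by blast
        moreover have "c \<noteq> 2"
          using p(2) unfolding t u Cons by simp
        ultimately show ?thesis
          using Cons by simp
      qed simp
      moreover have "good u"
        using good_t u by simp
      ultimately obtain r where r: "good r" "u = map (\<lambda>x. x + 2) r"
        using good_unshift[of u 2] by blast
      then have "sparse r"
        using p good_1_1_iff[of r] unfolding t u by blast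
      then show ?thesis
        using r unfolding t u by blast
    qed
  qed
next
  fix p assume "p \<in> ?R"
  then consider r where "good r" "p = map (\<lambda>x. x + 2) r"
    | r where "good r" "p = 1 # map (\<lambda>x. x + 2) r"
    | r where "good r" "sparse r" "p = 1 # 1 # map (\<lambda>x. x + 2) r"
    by auto
  then have "good p \<and> 2 \<notin> set p"
  proof cases
    case (1 r)
    then show ?thesis
      using good_shift[OF 1(1), of 2] good_parts_pos[OF 1(1)] unfolding 1(2) by force
  next
    case (2 r)
    then show ?thesis
      using good_1_shift_2[OF 2(1)] good_parts_pos[OF 2(1)] unfolding 2(2) by force
  next
    case (3 r)
    then show ?thesis
      using good_1_1_iff[OF 3(1)] 3(2) good_parts_pos[OF 3(1)] unfolding 3(3) by force
  qed
  then show "p \<in> ?L"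
    by simp
qed

subsection \<open>Series in \<open>x\<close> with coefficients in \<open>q\<close>\<close>

text \<open>The ring embedding of series in \<open>q\<close> alone: it sends \<open>fps_X\<close> to
  \<open>var_q\<close>, and its values do not involve \<open>x\<close>.\<close>

definition lift :: "rat fps \<Rightarrow> series_xq" where
  "lift f = Abs_fps (\<lambda>n. fps_const (fps_nth f n))"

lemma lift_nth [simp]: "fps_nth (lift f) n = fps_const (fps_nth f n)"
  by (simp add: lift_def)

lemma lift_1 [simp]: "lift 1 = 1"
  by (rule fps_ext) simp

lemma lift_X [simp]: "lift fps_X = var_q"
  by (rule fps_ext) (simp add: var_q_def)

lemma lift_diff [simp]: "lift (f - g) = lift f - lift g"
  by (rule fps_ext) simp

lemma lift_mult [simp]: "lift (f * g) = lift f * lift g"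
proof (rule fps_ext)
  have "fps_const (sum h A) = (\<Sum>i\<in>A. fps_const (h i))" for h :: "nat \<Rightarrow> rat" and A
    by (induction A rule: infinite_finite_induct) (simp_all flip: fps_const_add)
  then show "fps_nth (lift (f * g)) n = fps_nth (lift f * lift g) n" for n
    by (simp add: fps_mult_nth)
qed

lemma lift_power [simp]: "lift (f ^ n) = lift f ^ n"
  by (induction n) simp_all

lemma lift_qpoch [simp]: "lift (qpoch a q n) = qpoch (lift a) (lift q) n"
  by (induction n) (simp_all add: qpoch_def)

lemma qpoch_nth_0:
  fixes a q :: "'a::comm_ring_1 fps"
  assumes "fps_nth a 0 = 0"
  shows "fps_nth (qpoch a q n) 0 = 1"
  using assms by (induction n) (simp_all add: qpoch_def)

text \<open>Since \<open>d\<close> is invertible over the rationals, \<open>lift d\<close> is a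
  unit, and both sides give \<open>f\<close> when multiplied by it.\<close>

lemma divide_lift:
  assumes "fps_nth d 0 = 1"
  shows "f / lift d = f * lift (inverse d)"
proof -
  have "d * inverse d = 1"
    using assms by (simp add: inverse_mult_eq_1')
  then have *: "lift d * lift (inverse d) = 1"
    by (metis lift_1 lift_mult)
  have "f / lift d * lift d = f"
    using assms by (intro series_xq_divide_mult_cancel) simp
  then show ?thesis
    using * by (metis mult.assoc mult.right_neutral)
qed

text \<open>The sum of all \<open>x^m * g m\<close>. The proof computes for fixed \<open>m\<close>,
  whereas \<open>series_xq\<close> has \<open>q\<close> as its outer variable, so the two indices
  are transposed.\<close>

definition swap :: "(nat \<Rightarrow> rat fps) \<Rightarrow> series_xq" where
  "swap g = Abs_fps (\<lambda>n. Abs_fps (\<lambda>m. fps_nth (g m) n))"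

lemma swap_add: "swap f + swap g = swap (\<lambda>m. f m + g m)"
  by (intro fps_ext) (simp add: swap_def)

text \<open>For q-adic convergence it suffices that each power of \<open>q\<close> receives finitely
  many nonzero contributions; sorting these by \<open>N i\<close> gives the coefficients in
  \<open>x\<close>.\<close>

lemma has_sum_bigraded:
  fixes f :: "'i \<Rightarrow> rat fps" and N :: "'i \<Rightarrow> nat"
  assumes fin: "\<And>n. finite {i\<in>I. fps_nth (f i) n \<noteq> 0}"
    and g: "\<And>m n. fps_nth (g m) n = (\<Sum>i | i \<in> I \<and> fps_nth (f i) n \<noteq> 0 \<and> N i = m. fps_nth (f i) n)"
  shows "((\<lambda>i. var_x ^ N i * lift (f i)) has_sum swap g) I"
proof -
  have nth: "fps_nth (var_x ^ N i * lift (f i)) n = fps_X ^ N i * fps_const (fps_nth (f i) n)" for i n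
    by (simp add: var_x_def fps_const_power)
  have nz: "fps_X ^ N i * fps_const (fps_nth (f i) n) \<noteq> 0 \<longleftrightarrow> fps_nth (f i) n \<noteq> 0" for i n
    by simp
  show ?thesis
  proof (rule has_sum_fpsI, unfold nth nz)
    fix n
    show "finite {i\<in>I. fps_nth (f i) n \<noteq> 0}"
      by (rule fin)
    have "fps_nth (fps_nth (swap g) n) m =
        fps_nth (\<Sum>i | i \<in> I \<and> fps_nth (f i) n \<noteq> 0. fps_X ^ N i * fps_const (fps_nth (f i) n)) m" for m
    proof -
      have "fps_nth (fps_nth (swap g) n) m =
          (\<Sum>i | i \<in> I \<and> fps_nth (f i) n \<noteq> 0 \<and> N i = m. fps_nth (f i) n)"
        by (simp add: swap_def g)
      also have "\<dots> = (\<Sum>i | i \<in> I \<and> fps_nth (f i) n \<noteq> 0. if N i = m then fps_nth (f i) n else 0)"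
        using fin[of n] by (subst sum.inter_filter[symmetric]) (auto intro!: sum.cong)
      finally show ?thesis
        by (auto simp: fps_sum_nth fps_X_power_mult_nth intro!: sum.cong)
    qed
    then show "fps_nth (swap g) n =
        (\<Sum>i | i \<in> I \<and> fps_nth (f i) n \<noteq> 0. fps_X ^ N i * fps_const (fps_nth (f i) n))"
      by (rule fps_ext)
  qed
qed

text \<open>Convergence means that every coefficient of the partial sums is eventually constant, and
  this is preserved by addition.\<close>

lemma has_sum_fps_add:
  fixes f g :: "'i \<Rightarrow> 'a::ab_group_add fps"
  assumes "(f has_sum s) I" "(g has_sum t) I"
  shows "((\<lambda>i. f i + g i) has_sum s + t) I"
  unfolding has_sum_def
proof (rule tendsto_fpsI)
  fix n
  have "\<forall>\<^sub>F X in finite_subsets_at_top I. fps_nth (sum f X) n = fps_nth s n"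
    "\<forall>\<^sub>F X in finite_subsets_at_top I. fps_nth (sum g X) n = fps_nth t n"
    using assms unfolding has_sum_def tendsto_fps_iff by blast+
  then show "\<forall>\<^sub>F X in finite_subsets_at_top I. fps_nth (\<Sum>i\<in>X. f i + g i) n = fps_nth (s + t) n"
    by eventually_elim (simp add: sum.distrib)
qed

subsection \<open>The triple sums\<close>

definition wt :: "nat \<times> nat \<times> nat \<Rightarrow> nat" where
  "wt = (\<lambda>(i, j, k). i + 2 * j + 3 * k)"

definition denom :: "nat \<times> nat \<times> nat \<Rightarrow> rat fps" where
  "denom = (\<lambda>(i, j, k). qpoch fps_X fps_X i * qpoch (fps_X ^ 2) (fps_X ^ 2) j *
     qpoch (fps_X ^ 3) (fps_X ^ 3) k)"

definition expo :: "nat \<Rightarrow> nat \<Rightarrow> nat \<Rightarrow> nat \<times> nat \<times> nat \<Rightarrow> nat" where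
  "expo a b c = (\<lambda>(i, j, k). let N = i + 2 * j + 3 * k in
     N * (N - 1) div 2 + j\<^sup>2 + a * i + b * j + c * k)"

definition summand :: "nat \<Rightarrow> nat \<Rightarrow> nat \<Rightarrow> nat \<times> nat \<times> nat \<Rightarrow> rat fps" where
  "summand a b c t = fps_X ^ expo a b c t * inverse (denom t)"

definition H :: "nat \<Rightarrow> nat \<Rightarrow> nat \<Rightarrow> nat \<Rightarrow> rat fps" where
  "H a b c m = (\<Sum>t | wt t = m. summand a b c t)"

lemma finite_wt: "finite {t. wt t = m}"
proof (rule finite_subset)
  show "{t. wt t = m} \<subseteq> {..m} \<times> {..m} \<times> {..m}"
    by (auto simp: wt_def)
qed simp

lemma denom_nth_0: "fps_nth (denom t) 0 = 1"
  by (cases t) (simp add: denom_def qpoch_nth_0)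

text \<open>This is the substitution of \<open>x * q^s\<close> for \<open>x\<close>, because each
  summand gains the factor \<open>q\<close> to the power \<open>s * N\<close>.\<close>

lemma H_shift:
  assumes "a' = a + s" "b' = b + 2 * s" "c' = c + 3 * s"
  shows "H a' b' c' m = fps_X ^ (s * m) * H a b c m"
proof -
  have "summand a' b' c' t = fps_X ^ (s * wt t) * summand a b c t" for t
    by (cases t) (simp add: assms summand_def expo_def wt_def Let_def algebra_simps power_add)
  then show ?thesis
    by (simp add: H_def sum_distrib_left)
qed

text \<open>The common form of the three contiguous relations. The map \<open>up\<close> raises one
  index by 1; the two families agree where that index is 0, so their difference can be reindexed
  along \<open>up\<close>, which lowers the weight by \<open>s\<close>.\<close>

lemma H_step:
  fixes up :: "nat \<times> nat \<times> nat \<Rightarrow> nat \<times> nat \<times> nat"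
  assumes wt: "\<And>t. wt (up t) = wt t + s"
    and inj: "inj up"
    and 0: "\<And>t. t \<notin> range up \<Longrightarrow> summand a b c t = summand a' b' c' t"
    and 1: "\<And>t. summand a b c (up t) = summand a' b' c' (up t) + fps_X ^ e * summand a'' b'' c'' t"
  shows "H a b c m = H a' b' c' m + (if s \<le> m then fps_X ^ e * H a'' b'' c'' (m - s) else 0)"
proof -
  define d where "d = (\<lambda>t. summand a b c t - summand a' b' c' t)"
  have "(\<Sum>t | wt t = m. d t) = (\<Sum>t\<in>up ` {t. wt t + s = m}. d t)"
  proof (rule sum.mono_neutral_right)
    show "\<forall>t\<in>{t. wt t = m} - up ` {t. wt t + s = m}. d t = 0"
      by (auto simp: d_def wt intro!: 0)
  qed (auto simp: finite_wt wt)
  also have "\<dots> = (\<Sum>t | wt t + s = m. d (up t))"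
    using inj by (subst sum.reindex) (auto simp: inj_on_def o_def)
  also have "\<dots> = (\<Sum>t | wt t + s = m. fps_X ^ e * summand a'' b'' c'' t)"
    by (simp add: d_def 1)
  also have "\<dots> = (if s \<le> m then fps_X ^ e * H a'' b'' c'' (m - s) else 0)"
    by (auto simp: H_def sum_distrib_left intro!: sum.cong)
  finally show ?thesis
    by (simp add: d_def H_def sum_subtractf algebra_simps)
qed

section \<open>Triangular exponents and the contiguous relations\<close>

lemma tri_Suc: "Suc N * N div 2 = N * (N - 1) div 2 + N"
proof -
  have "Suc N * N = N * (N - 1) + N * 2"
    by (cases N) (simp_all add: algebra_simps)
  then show ?thesis
    by simp
qed

lemma tri_shift:
  fixes N :: nat
  shows
  "(N + 1) * N div 2 = N * (N - 1) div 2 + N"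
  "(N + 2) * (N + 1) div 2 = N * (N - 1) div 2 + 2 * N + 1"
  "(N + 3) * (N + 2) div 2 = N * (N - 1) div 2 + 3 * N + 3"
  using tri_Suc[of N] tri_Suc[of "N + 1"] tri_Suc[of "N + 2"]
  by (simp_all add: numeral_2_eq_2 numeral_3_eq_3)

text \<open>
  The difference of the two summands at \<open>t'\<close> has a factor \<open>1 - q\<^sup>r\<close>, which cancels the last
  factor of a Pochhammer symbol.
\<close>
lemma summand_step:
  assumes denom: "denom t' = denom t * (1 - fps_X ^ r)" and "r > 0"
    and "expo a b c t' = e + expo a'' b'' c'' t"
    and "expo a' b' c' t' = expo a b c t' + r"
  shows "summand a b c t' = summand a' b' c' t' + fps_X ^ e * summand a'' b'' c'' t"
proof -
  define u where "u = 1 - (fps_X :: rat fps) ^ r"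
  have "fps_nth u 0 = 1"
    using \<open>r > 0\<close> by (simp add: u_def)
  then have "inverse (denom t') * u = inverse (denom t)"
    by (simp add: denom fps_inverse_mult mult.assoc inverse_mult_eq_1 flip: u_def)
  then have "fps_X ^ e * summand a'' b'' c'' t = fps_X ^ expo a b c t' * (inverse (denom t') * u)"
    using assms(3) by (simp add: summand_def power_add mult.assoc)
  then show ?thesis
    using assms(4) by (simp add: summand_def u_def power_add algebra_simps)
qed

text \<open>Raising i by 1 adds N = i + 2j + 3k to the triangular exponent, whence the increments 1,
  2, 3.\<close>

lemma H_step_i:
  "H a b c m = H (a + 1) b c m + (if 1 \<le> m then fps_X ^ a * H (a + 1) (b + 2) (c + 3) (m - 1) else 0)"
proof (rule H_step[where up = "\<lambda>(i, j, k). (i + 1, j, k)"])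
  fix t show "t \<notin> range (\<lambda>(i, j, k). (i + 1, j, k)) \<Longrightarrow> summand a b c t = summand (a + 1) b c t"
  proof (cases t)
    case (fields i j k)
    assume "t \<notin> range (\<lambda>(i, j, k). (i + 1, j, k))"
    then have "i = 0"
      unfolding fields by (cases i) (auto simp: image_iff)
    then show ?thesis
      by (simp add: fields summand_def expo_def)
  qed
next
  fix t :: "nat \<times> nat \<times> nat"
  obtain i j k where t: "t = (i, j, k)"
    by (cases t)
  have N: "i + 1 + 2 * j + 3 * k = (i + 2 * j + 3 * k) + 1"
    by simp
  show "summand a b c ((\<lambda>(i, j, k). (i + 1, j, k)) t) =
      summand (a + 1) b c ((\<lambda>(i, j, k). (i + 1, j, k)) t) +
      fps_X ^ a * summand (a + 1) (b + 2) (c + 3) t"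
  proof (rule summand_step[where r = "i + 1"])
    show "denom ((\<lambda>(i, j, k). (i + 1, j, k)) t) = denom t * (1 - fps_X ^ (i + 1))"
      by (simp add: t denom_def qpoch_def)
    show "expo a b c ((\<lambda>(i, j, k). (i + 1, j, k)) t) = a + expo (a + 1) (b + 2) (c + 3) t"
      unfolding t expo_def Let_def prod.case N add_diff_cancel_right' tri_shift
      by (simp add: algebra_simps)
    show "expo (a + 1) b c ((\<lambda>(i, j, k). (i + 1, j, k)) t) =
        expo a b c ((\<lambda>(i, j, k). (i + 1, j, k)) t) + (i + 1)"
      by (simp add: t expo_def)
  qed simp
qed (auto simp: wt_def inj_def)

text \<open>Raising j by 1 adds 2N + 1 to the triangular exponent and 2j + 1 to the square, in total
  2i + 6j + 6k + 2.\<close>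

lemma H_step_j:
  "H a b c m = H a (b + 2) c m + (if 2 \<le> m then fps_X ^ (b + 2) * H (a + 2) (b + 6) (c + 6) (m - 2) else 0)"
proof (rule H_step[where up = "\<lambda>(i, j, k). (i, j + 1, k)"])
  fix t show "t \<notin> range (\<lambda>(i, j, k). (i, j + 1, k)) \<Longrightarrow> summand a b c t = summand a (b + 2) c t"
  proof (cases t)
    case (fields i j k)
    assume "t \<notin> range (\<lambda>(i, j, k). (i, j + 1, k))"
    then have "j = 0"
      unfolding fields by (cases j) (auto simp: image_iff)
    then show ?thesis
      by (simp add: fields summand_def expo_def)
  qed
next
  fix t :: "nat \<times> nat \<times> nat"
  obtain i j k where t: "t = (i, j, k)"
    by (cases t)
  have N: "i + 2 * (j + 1) + 3 * k = (i + 2 * j + 3 * k) + 2"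
    by simp
  have N': "n + 2 - 1 = n + 1" for n :: nat
    by simp
  show "summand a b c ((\<lambda>(i, j, k). (i, j + 1, k)) t) =
      summand a (b + 2) c ((\<lambda>(i, j, k). (i, j + 1, k)) t) +
      fps_X ^ (b + 2) * summand (a + 2) (b + 6) (c + 6) t"
  proof (rule summand_step[where r = "2 * (j + 1)"])
    have "(fps_X :: rat fps)\<^sup>2 * fps_X\<^sup>2 ^ j = fps_X ^ (2 * (j + 1))"
      by (simp only: power_mult power_Suc Suc_eq_plus1[symmetric])
    then show "denom ((\<lambda>(i, j, k). (i, j + 1, k)) t) = denom t * (1 - fps_X ^ (2 * (j + 1)))"
      by (simp add: t denom_def qpoch_def mult_ac)
    show "expo a b c ((\<lambda>(i, j, k). (i, j + 1, k)) t) = b + 2 + expo (a + 2) (b + 6) (c + 6) t"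
      unfolding t expo_def Let_def prod.case N N' tri_shift
      by (simp add: algebra_simps power2_eq_square)
    show "expo a (b + 2) c ((\<lambda>(i, j, k). (i, j + 1, k)) t) =
        expo a b c ((\<lambda>(i, j, k). (i, j + 1, k)) t) + 2 * (j + 1)"
      by (simp add: t expo_def Let_def algebra_simps)
  qed simp
qed (auto simp: wt_def inj_def)

text \<open>Raising k by 1 adds 3N + 3 = 3i + 6j + 9k + 3 to the triangular exponent.\<close>

lemma H_step_k:
  "H a b c m = H a b (c + 3) m + (if 3 \<le> m then fps_X ^ (c + 3) * H (a + 3) (b + 6) (c + 9) (m - 3) else 0)"
proof (rule H_step[where up = "\<lambda>(i, j, k). (i, j, k + 1)"])
  fix t show "t \<notin> range (\<lambda>(i, j, k). (i, j, k + 1)) \<Longrightarrow> summand a b c t = summand a b (c + 3) t"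
  proof (cases t)
    case (fields i j k)
    assume "t \<notin> range (\<lambda>(i, j, k). (i, j, k + 1))"
    then have "k = 0"
      unfolding fields by (cases k) (auto simp: image_iff)
    then show ?thesis
      by (simp add: fields summand_def expo_def)
  qed
next
  fix t :: "nat \<times> nat \<times> nat"
  obtain i j k where t: "t = (i, j, k)"
    by (cases t)
  have N: "i + 2 * j + 3 * (k + 1) = (i + 2 * j + 3 * k) + 3"
    by simp
  have N': "n + 3 - 1 = n + 2" for n :: nat
    by simp
  show "summand a b c ((\<lambda>(i, j, k). (i, j, k + 1)) t) =
      summand a b (c + 3) ((\<lambda>(i, j, k). (i, j, k + 1)) t) +
      fps_X ^ (c + 3) * summand (a + 3) (b + 6) (c + 9) t"
  proof (rule summand_step[where r = "3 * (k + 1)"])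
    have "(fps_X :: rat fps) ^ 3 * (fps_X ^ 3) ^ k = fps_X ^ (3 * (k + 1))"
      by (simp only: power_mult power_Suc Suc_eq_plus1[symmetric])
    then show "denom ((\<lambda>(i, j, k). (i, j, k + 1)) t) = denom t * (1 - fps_X ^ (3 * (k + 1)))"
      by (simp add: t denom_def qpoch_def mult_ac)
    show "expo a b c ((\<lambda>(i, j, k). (i, j, k + 1)) t) = c + 3 + expo (a + 3) (b + 6) (c + 9) t"
      unfolding t expo_def Let_def prod.case N N' tri_shift
      by (simp add: algebra_simps)
    show "expo a b (c + 3) ((\<lambda>(i, j, k). (i, j, k + 1)) t) =
        expo a b c ((\<lambda>(i, j, k). (i, j, k + 1)) t) + 3 * (k + 1)"
      by (simp add: t expo_def Let_def algebra_simps)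
  qed simp
qed (auto simp: wt_def inj_def)

lemma H_0: "H a b c 0 = 1"
proof -
  have "{t. wt t = 0} = {(0, 0, 0)}"
    by (auto simp: wt_def)
  then show ?thesis
    by (simp add: H_def summand_def expo_def denom_def qpoch_def)
qed

subsection \<open>Generating functions of sets of partitions\<close>

text \<open>The coefficient of \<open>x^m\<close> in the generating function of \<open>S\<close>, as
  a series in \<open>q\<close>.\<close>

definition pgf :: "nat list set \<Rightarrow> nat \<Rightarrow> rat fps" where
  "pgf S m = Abs_fps (\<lambda>n. of_nat (card {p\<in>S. length p = m \<and> sum_list p = n}))"

lemma finite_lists_length_sum: "finite {p \<in> S. length p = m \<and> sum_list p = (n::nat)}"
proof (rule finite_subset)
  show "{p \<in> S. length p = m \<and> sum_list p = n} \<subseteq> {p. set p \<subseteq> {..n} \<and> length p \<le> m}"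
    by (auto simp: member_le_sum_list)
qed (simp add: finite_lists_length_le)

lemma pgf_Un: "S \<inter> T = {} \<Longrightarrow> pgf (S \<union> T) m = pgf S m + pgf T m"
proof (rule fps_ext)
  fix n
  assume "S \<inter> T = {}"
  moreover have "{p \<in> S \<union> T. length p = m \<and> sum_list p = n} =
      {p \<in> S. length p = m \<and> sum_list p = n} \<union> {p \<in> T. length p = m \<and> sum_list p = n}"
    by auto
  ultimately show "fps_nth (pgf (S \<union> T) m) n = fps_nth (pgf S m + pgf T m) n"
    using finite_lists_length_sum[of S m n] finite_lists_length_sum[of T m n]
    by (simp add: pgf_def card_Un_disjoint disjoint_iff)
qed

text \<open>Shifting all parts by \<open>k\<close> and adding \<open>s\<close> parts of total size
  \<open>e\<close> substitutes \<open>x * q^k\<close> for \<open>x\<close> and multiplies by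
  \<open>x^s * q^e\<close>.\<close>

lemma pgf_image:
  assumes inj: "inj_on g S"
    and len: "\<And>p. p \<in> S \<Longrightarrow> length (g p) = length p + s"
    and sum: "\<And>p. p \<in> S \<Longrightarrow> sum_list (g p) = sum_list p + k * length p + e"
  shows "pgf (g ` S) m = (if s \<le> m then fps_X ^ (k * (m - s) + e) * pgf S (m - s) else 0)"
proof (rule fps_ext)
  fix n
  define A where "A = {p\<in>S. length p + s = m \<and> sum_list p + k * length p + e = n}"
  have "{p \<in> g ` S. length p = m \<and> sum_list p = n} = g ` A"
    by (auto simp: A_def len sum)
  then have "fps_nth (pgf (g ` S) m) n = of_nat (card A)"
    using inj by (simp add: pgf_def card_image A_def inj_on_def)
  moreover have "A = {}" if "m < s \<or> n < k * (m - s) + e"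
    using that by (auto simp: A_def)
  moreover have "A = {p\<in>S. length p = m - s \<and> sum_list p = n - (k * (m - s) + e)}"
    if "s \<le> m" "k * (m - s) + e \<le> n"
    using that by (auto simp: A_def)
  ultimately show "fps_nth (pgf (g ` S) m) n =
      fps_nth (if s \<le> m then fps_X ^ (k * (m - s) + e) * pgf S (m - s) else 0) n"
    by (auto simp: fps_X_power_mult_nth pgf_def not_le)
qed

lemma pgf_0: "[] \<in> S \<Longrightarrow> pgf S 0 = 1"
proof (rule fps_ext)
  fix n
  assume "[] \<in> S"
  then have "{p \<in> S. length p = 0 \<and> sum_list p = n} = (if n = 0 then {[]} else {})"
    by auto
  then show "fps_nth (pgf S 0) n = fps_nth 1 n"
    by (simp add: pgf_def)
qed

lemma sum_list_shift: "sum_list (map (\<lambda>x. x + k) p) = sum_list p + k * length (p :: nat list)"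
  by (induction p) simp_all

lemma inj_shift: "inj (map (\<lambda>x. x + k :: nat))"
  by (intro injI) (simp add: inj_map_eq_map inj_def)

lemma inj_Cons: "inj_on g S \<Longrightarrow> inj_on (\<lambda>r. a # g r) S"
  by (auto simp: inj_on_def)

lemmas pgf_image_rules =
  pgf_image[OF inj_on_subset[OF inj_shift subset_UNIV]]
  pgf_image[OF inj_Cons[OF inj_on_subset[OF inj_shift subset_UNIV]]]
  pgf_image[OF inj_Cons[OF inj_Cons[OF inj_on_subset[OF inj_shift subset_UNIV]]]]
  pgf_image[OF inj_Cons[OF inj_Cons[OF inj_Cons[OF inj_on_subset[OF inj_shift subset_UNIV]]]]]

section \<open>The functional equations for \<open>A\<close> and \<open>B\<close>, read off at
  \<open>x^m\<close>\<close>

definition solves :: "(nat \<Rightarrow> rat fps) \<Rightarrow> (nat \<Rightarrow> rat fps) \<Rightarrow> bool" where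
  "solves a b \<longleftrightarrow> (\<forall>m.
     b m = fps_X ^ m * a m + (if 1 \<le> m then fps_X ^ m * b (m - 1) else 0) \<and>
     a m = b m + (if 2 \<le> m then fps_X ^ (2 * (m - 2) + 2) * b (m - 2) else 0)
               + (if 3 \<le> m then fps_X ^ (3 * (m - 3) + 4) * a (m - 3) else 0))"

text \<open>Eliminating \<open>b m\<close> leaves \<open>(1 - q^m) * a m\<close> equal to terms of
  smaller index. For \<open>m = 0\<close> the system only says \<open>a 0 = b 0\<close>, so the
  initial value is prescribed.\<close>

lemma solves_unique:
  assumes "solves a b" "solves a' b'" "a 0 = a' 0"
  shows "a m = a' m \<and> b m = b' m"
proof (induction m rule: less_induct)
  case (less m)
  have b: "b m = fps_X ^ m * a m + (if 1 \<le> m then fps_X ^ m * b (m - 1) else 0)"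
    "b' m = fps_X ^ m * a' m + (if 1 \<le> m then fps_X ^ m * b' (m - 1) else 0)"
    using assms unfolding solves_def by blast+
  show ?case
  proof (cases "m = 0")
    case True
    then show ?thesis
      using b assms(3) by simp
  next
    case False
    \<comment> \<open>Everything of index below \<open>m\<close>; by induction it is the same for
      both solutions.\<close>
    define r where "r = fps_X ^ m * b (m - 1) +
      (if 2 \<le> m then fps_X ^ (2 * (m - 2) + 2) * b (m - 2) else 0) +
      (if 3 \<le> m then fps_X ^ (3 * (m - 3) + 4) * a (m - 3) else 0)"
    have IH: "b (m - 1) = b' (m - 1)" "2 \<le> m \<Longrightarrow> b (m - 2) = b' (m - 2)"
      "3 \<le> m \<Longrightarrow> a (m - 3) = a' (m - 3)"
      using less False by auto
    have "a m = b m + (if 2 \<le> m then fps_X ^ (2 * (m - 2) + 2) * b (m - 2) else 0)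
               + (if 3 \<le> m then fps_X ^ (3 * (m - 3) + 4) * a (m - 3) else 0)"
      using assms(1) unfolding solves_def by blast
    then have a: "a m = fps_X ^ m * a m + r"
      using False unfolding b r_def by (simp add: algebra_simps)
    have "a' m = b' m + (if 2 \<le> m then fps_X ^ (2 * (m - 2) + 2) * b' (m - 2) else 0)
               + (if 3 \<le> m then fps_X ^ (3 * (m - 3) + 4) * a' (m - 3) else 0)"
      using assms(2) unfolding solves_def by blast
    moreover have "r = fps_X ^ m * b' (m - 1) +
      (if 2 \<le> m then fps_X ^ (2 * (m - 2) + 2) * b' (m - 2) else 0) +
      (if 3 \<le> m then fps_X ^ (3 * (m - 3) + 4) * a' (m - 3) else 0)"
      unfolding r_def using IH by (simp cong: if_cong)
    ultimately have "a' m = fps_X ^ m * a' m + r"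
      using False unfolding b by (simp add: algebra_simps)
    with a have "a m - fps_X ^ m * a m = r" "a' m - fps_X ^ m * a' m = r"
      by (metis add.commute diff_eq_eq)+
    then have "(1 - fps_X ^ m) * (a m - a' m) = 0"
      by (simp add: left_diff_distrib right_diff_distrib)
    moreover have "1 - fps_X ^ m \<noteq> (0 :: rat fps)"
    proof
      assume "1 - fps_X ^ m = (0 :: rat fps)"
      then have "fps_nth (1 - fps_X ^ m :: rat fps) 0 = 0"
        by simp
      then show False
        using \<open>m \<noteq> 0\<close> by simp
    qed
    ultimately have "a m = a' m"
      by simp
    then show ?thesis
      using b IH(1) by simp
  qed
qed

text \<open>The pieces of \<open>sparse_decomp\<close> and \<open>good_decomp\<close> are disjoint,
  being told apart by their initial ones and twos, so each decomposition becomes an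
  equation.\<close>

lemma pgf_solves: "solves (pgf {p. good p}) (pgf {p. good p \<and> sparse p})"
proof -
  have "pgf {p. good p \<and> sparse p} m = fps_X ^ m * pgf {p. good p} m +
      (if 1 \<le> m then fps_X ^ m * pgf {p. good p \<and> sparse p} (m - 1) else 0)" for m
  proof -
    have "map (\<lambda>x. x + 1) ` {p. good p} \<inter>
        (\<lambda>r. 1 # map (\<lambda>x. x + 1) r) ` {p. good p \<and> sparse p} = {}"
      by (auto simp: map_eq_Cons_conv)
    moreover have "pgf (map (\<lambda>x. x + 1) ` {p. good p}) m = fps_X ^ m * pgf {p. good p} m"
      by (subst pgf_image_rules(1)[where s = 0 and k = 1 and e = 0]) (simp_all add: sum_list_shift del: One_nat_def)
    moreover have "pgf ((\<lambda>r. 1 # map (\<lambda>x. x + 1) r) ` {p. good p \<and> sparse p}) m =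
        (if 1 \<le> m then fps_X ^ m * pgf {p. good p \<and> sparse p} (m - 1) else 0)"
      by (subst pgf_image_rules(2)[where s = 1 and k = 1 and e = 1]) (simp_all add: sum_list_shift del: One_nat_def)
    ultimately show ?thesis
      by (subst sparse_decomp) (simp only: pgf_Un)
  qed
  moreover have "pgf {p. good p} m = pgf {p. good p \<and> sparse p} m +
      (if 2 \<le> m then fps_X ^ (2 * (m - 2) + 2) * pgf {p. good p \<and> sparse p} (m - 2) else 0) +
      (if 3 \<le> m then fps_X ^ (3 * (m - 3) + 4) * pgf {p. good p} (m - 3) else 0)" for m
  proof -
    have "{p. good p \<and> sparse p} \<inter>
        (\<lambda>r. 1 # 1 # map (\<lambda>x. x + 2) r) ` {p. good p \<and> sparse p} = {}"
      by auto
    moreover have "({p. good p \<and> sparse p} \<union>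
        (\<lambda>r. 1 # 1 # map (\<lambda>x. x + 2) r) ` {p. good p \<and> sparse p}) \<inter>
        (\<lambda>r. 1 # 1 # 2 # map (\<lambda>x. x + 3) r) ` {p. good p} = {}"
      by (auto simp: map_eq_Cons_conv Cons_eq_map_conv)
    moreover have "pgf ((\<lambda>r. 1 # 1 # map (\<lambda>x. x + 2) r) ` {p. good p \<and> sparse p}) m =
        (if 2 \<le> m then fps_X ^ (2 * (m - 2) + 2) * pgf {p. good p \<and> sparse p} (m - 2) else 0)"
      by (subst pgf_image_rules(3)[where s = 2 and k = 2 and e = 2]) (simp_all add: sum_list_shift del: add_2_eq_Suc')
    moreover have "pgf ((\<lambda>r. 1 # 1 # 2 # map (\<lambda>x. x + 3) r) ` {p. good p}) m =
        (if 3 \<le> m then fps_X ^ (3 * (m - 3) + 4) * pgf {p. good p} (m - 3) else 0)"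
      by (subst pgf_image_rules(4)[where s = 3 and k = 3 and e = 4]) (simp_all add: sum_list_shift del: add_2_eq_Suc')
    ultimately show ?thesis
      by (subst good_decomp) (simp only: pgf_Un)
  qed
  ultimately show ?thesis
    unfolding solves_def by blast
qed

lemma pgf_without_2:
  "pgf {p. good p \<and> 2 \<notin> set p} m = fps_X ^ (2 * m) * pgf {p. good p} m +
      (if 1 \<le> m then fps_X ^ (2 * (m - 1) + 1) * pgf {p. good p} (m - 1) else 0) +
      (if 2 \<le> m then fps_X ^ (2 * (m - 2) + 2) * pgf {p. good p \<and> sparse p} (m - 2) else 0)"
proof -
  have "map (\<lambda>x. x + 2) ` {p. good p} \<inter> (\<lambda>r. 1 # map (\<lambda>x. x + 2) r) ` {p. good p} = {}"
    by (auto simp: map_eq_Cons_conv Cons_eq_map_conv)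
  moreover have "(map (\<lambda>x. x + 2) ` {p. good p} \<union> (\<lambda>r. 1 # map (\<lambda>x. x + 2) r) ` {p. good p}) \<inter>
      (\<lambda>r. 1 # 1 # map (\<lambda>x. x + 2) r) ` {p. good p \<and> sparse p} = {}"
    by (auto simp: map_eq_Cons_conv Cons_eq_map_conv)
  moreover have "pgf (map (\<lambda>x. x + 2) ` {p. good p}) m = fps_X ^ (2 * m) * pgf {p. good p} m"
    by (subst pgf_image_rules(1)[where s = 0 and k = 2 and e = 0]) (simp_all add: sum_list_shift del: add_2_eq_Suc')
  moreover have "pgf ((\<lambda>r. 1 # map (\<lambda>x. x + 2) r) ` {p. good p}) m =
      (if 1 \<le> m then fps_X ^ (2 * (m - 1) + 1) * pgf {p. good p} (m - 1) else 0)"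
    by (subst pgf_image_rules(2)[where s = 1 and k = 2 and e = 1]) (simp_all add: sum_list_shift del: add_2_eq_Suc')
  moreover have "pgf ((\<lambda>r. 1 # 1 # map (\<lambda>x. x + 2) r) ` {p. good p \<and> sparse p}) m =
      (if 2 \<le> m then fps_X ^ (2 * (m - 2) + 2) * pgf {p. good p \<and> sparse p} (m - 2) else 0)"
    by (subst pgf_image_rules(3)[where s = 2 and k = 2 and e = 2]) (simp_all add: sum_list_shift del: add_2_eq_Suc')
  ultimately show ?thesis
    by (subst without_2_decomp) (simp only: pgf_Un)
qed

lemma H_solves: "solves (H 1 0 1) (H 1 2 4)"
proof -
  have "H 1 2 4 m = fps_X ^ m * H 1 0 1 m + (if 1 \<le> m then fps_X ^ m * H 1 2 4 (m - 1) else 0)" for m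
  proof -
    have "H 2 2 4 m = fps_X ^ m * H 1 0 1 m"
      using H_shift[of 2 1 1 2 0 4 1] by simp
    moreover have "fps_X * H 2 4 7 (m - 1) = fps_X ^ m * H 1 2 4 (m - 1)" if "1 \<le> m"
      using H_shift[of 2 1 1 4 2 7 4 "m - 1"] that by (cases m) (simp_all add: mult_ac)
    ultimately show ?thesis
      using H_step_i[of 1 2 4 m] by (simp add: numeral_2_eq_2[symmetric])
  qed
  moreover have "H 1 0 1 m = H 1 2 4 m +
      (if 2 \<le> m then fps_X ^ (2 * (m - 2) + 2) * H 1 2 4 (m - 2) else 0) +
      (if 3 \<le> m then fps_X ^ (3 * (m - 3) + 4) * H 1 0 1 (m - 3) else 0)" for m
  proof -
    \<comment> \<open>Steps in j and k produce \<open>P\<close> and \<open>Q\<close>, while the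
      equation asks for \<open>R\<close> and \<open>S\<close>, which are shifts of
      \<open>H 1 2 4\<close> and \<open>H 1 0 1\<close>. A further step in k for \<open>P\<close>
      and in j for \<open>S\<close> leads to the same correction \<open>T\<close>.\<close>
    define P Q R S T where defs: "P = H 3 6 7 (m - 2)" "Q = H 4 8 10 (m - 3)"
      "R = H 3 6 10 (m - 2)" "S = H 4 6 10 (m - 3)" "T = H 6 12 16 (m - 5)"
    have PQ: "H 1 0 1 m = H 1 2 4 m + (if 2 \<le> m then fps_X ^ 2 * P else 0)
        + (if 3 \<le> m then fps_X ^ 4 * Q else 0)"
      using H_step_j[of 1 0 1 m] H_step_k[of 1 2 1 m] unfolding defs by (simp add: numeral_eq_Suc)
    have PR: "P = R + (if 5 \<le> m then fps_X ^ 10 * T else 0)" if "2 \<le> m"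
    proof -
      have "3 \<le> m - 2 \<longleftrightarrow> 5 \<le> m" "m - 2 - 3 = m - 5"
        using that by auto
      then show ?thesis
        using H_step_k[of 3 6 7 "m - 2"] unfolding defs by simp
    qed
    have SQ: "S = Q + (if 5 \<le> m then fps_X ^ 8 * T else 0)" if "3 \<le> m"
    proof -
      have "2 \<le> m - 3 \<longleftrightarrow> 5 \<le> m" "m - 3 - 2 = m - 5"
        using that by auto
      then show ?thesis
        using H_step_j[of 4 6 10 "m - 3"] unfolding defs by simp
    qed
    \<comment> \<open>Both corrections equal \<open>q^12 * T\<close>, so they cancel.\<close>
    have "fps_X ^ 2 * (fps_X ^ 10 * T) = fps_X ^ 4 * (fps_X ^ 8 * T)"
      by (simp flip: mult.assoc power_add)
    then have "(if 2 \<le> m then fps_X ^ 2 * P else 0) + (if 3 \<le> m then fps_X ^ 4 * Q else 0) =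
        (if 2 \<le> m then fps_X ^ 2 * R else 0) + (if 3 \<le> m then fps_X ^ 4 * S else 0)"
      using PR SQ by (cases "5 \<le> m") (auto simp: distrib_left)
    moreover have "R = fps_X ^ (2 * (m - 2)) * H 1 2 4 (m - 2)"
      "S = fps_X ^ (3 * (m - 3)) * H 1 0 1 (m - 3)"
      unfolding defs by (rule H_shift; simp)+
    then have "fps_X ^ 2 * R = fps_X ^ (2 * (m - 2) + 2) * H 1 2 4 (m - 2)"
      "fps_X ^ 4 * S = fps_X ^ (3 * (m - 3) + 4) * H 1 0 1 (m - 3)"
      by (simp_all only: power_add mult_ac)
    ultimately show ?thesis
      using PQ by (simp only: add.assoc)
  qed
  ultimately show ?thesis
    unfolding solves_def by blast
qed

lemma pgf_eq_H:
  "pgf {p. good p} m = H 1 0 1 m"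
  "pgf {p. good p \<and> sparse p} m = H 1 2 4 m"
proof -
  have "pgf {p. good p} 0 = H 1 0 1 0"
    by (simp add: pgf_0 H_0)
  then show "pgf {p. good p} m = H 1 0 1 m" "pgf {p. good p \<and> sparse p} m = H 1 2 4 m"
    using solves_unique[OF pgf_solves H_solves] by blast+
qed

section \<open>Convergence of the two sums and conclusion\<close>

lemma has_sum_triple:
  assumes "a > 0" "b > 0" "c > 0"
  shows "((\<lambda>t. var_x ^ (wt t + s) * lift (fps_X ^ e * summand a b c t)) has_sum
    swap (\<lambda>m. if s \<le> m then fps_X ^ e * H a b c (m - s) else 0)) UNIV"
proof -
  define f where "f = (\<lambda>t. fps_X ^ e * summand a b c t)"
  define g where "g = (\<lambda>m. if s \<le> m then fps_X ^ e * H a b c (m - s) else 0)"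
  have "finite {t \<in> UNIV. fps_nth (f t) n \<noteq> 0}" for n
  proof (rule finite_subset)
    show "{t \<in> UNIV. fps_nth (f t) n \<noteq> 0} \<subseteq> {..n} \<times> {..n} \<times> {..n}"
    proof (rule subsetI, rule ccontr)
      fix t
      assume t: "t \<in> {t \<in> UNIV. fps_nth (f t) n \<noteq> 0}" "t \<notin> {..n} \<times> {..n} \<times> {..n}"
      obtain i j k where "t = (i, j, k)"
        by (cases t)
      with t have nz: "fps_nth (f (i, j, k)) n \<noteq> 0" and "(i, j, k) \<notin> {..n} \<times> {..n} \<times> {..n}"
        by auto
      \<comment> \<open>Positive \<open>a\<close>, \<open>b\<close>, \<open>c\<close> make the
        exponent of \<open>q\<close> at least i + j + k, so a triple with an entry above
        \<open>n\<close> cannot contribute to \<open>q^n\<close>.\<close>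
      then have "n < i + j + k"
        by auto
      also have "\<dots> \<le> a * i + b * j + c * k"
        using assms by (intro add_mono) auto
      also have "\<dots> \<le> e + expo a b c (i, j, k)"
        by (simp add: expo_def Let_def)
      finally have "fps_nth (f (i, j, k)) n = 0"
        by (simp add: f_def summand_def fps_X_power_mult_nth flip: mult.assoc power_add)
      with nz show False
        by simp
    qed
  qed simp
  moreover have "fps_nth (g m) n =
      (\<Sum>t | t \<in> UNIV \<and> fps_nth (f t) n \<noteq> 0 \<and> wt t + s = m. fps_nth (f t) n)" for m n
  proof -
    have "fps_nth (g m) n =
        (\<Sum>t | wt t + s = m. fps_nth (f t) n)"
    proof (cases "s \<le> m")
      case True
      then have "{t. wt t + s = m} = {t. wt t = m - s}"
        by auto
      then show ?thesis
        using True by (simp add: g_def H_def f_def sum_distrib_left fps_sum_nth)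
    next
      case False
      then have "{t. wt t + s = m} = {}"
        by auto
      then show ?thesis
        using False by (simp add: g_def)
    qed
    also have "\<dots> = (\<Sum>t | t \<in> UNIV \<and> fps_nth (f t) n \<noteq> 0 \<and> wt t + s = m. fps_nth (f t) n)"
    proof (rule sum.mono_neutral_right)
      show "finite {t. wt t + s = m}"
        by (rule finite_subset[OF _ finite_wt[of "m - s"]]) auto
    qed auto
    finally show ?thesis .
  qed
  ultimately show ?thesis
    using has_sum_bigraded[of UNIV f g "\<lambda>t. wt t + s"] unfolding f_def g_def by blast
qed

text \<open>Positive parts bound the length by the size, so each size occurs finitely often.\<close>

lemma has_sum_partitions:
  assumes "\<And>p. p \<in> P \<Longrightarrow> is_partition p"
  shows "((\<lambda>p. var_x ^ length p * var_q ^ sum_list p) has_sum swap (pgf P)) P"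
proof -
  define f :: "nat list \<Rightarrow> rat fps" where "f = (\<lambda>p. fps_X ^ sum_list p)"
  have nth: "fps_nth (f p) n = (if sum_list p = n then 1 else 0)" for p n
    by (auto simp: f_def)
  have "((\<lambda>p. var_x ^ length p * lift (f p)) has_sum swap (pgf P)) P"
  proof (rule has_sum_bigraded)
    show "finite {p \<in> P. fps_nth (f p) n \<noteq> 0}" for n
    proof (rule finite_subset)
      have "length p \<le> sum_list p" if "is_partition p" for p
        using that by (induction p) (auto simp: is_partition_Cons)
      then show "{p \<in> P. fps_nth (f p) n \<noteq> 0} \<subseteq> {p. set p \<subseteq> {..n} \<and> length p \<le> n}"
        using assms by (auto simp: nth member_le_sum_list split: if_splits)
    qed (simp add: finite_lists_length_le)
    fix m n
    have "{p. p \<in> P \<and> fps_nth (f p) n \<noteq> 0 \<and> length p = m} = {p \<in> P. length p = m \<and> sum_list p = n}"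
      by (auto simp: nth)
    then show "fps_nth (pgf P m) n =
        (\<Sum>p | p \<in> P \<and> fps_nth (f p) n \<noteq> 0 \<and> length p = m. fps_nth (f p) n)"
      by (simp add: pgf_def nth)
  qed
  then show ?thesis
    by (simp add: f_def)
qed

theorem mainTheorem9:
  fixes P :: "nat list set"
    and F :: "nat \<times> nat \<times> nat \<Rightarrow> series_xq"
  defines "P \<equiv> {p. is_partition p \<and> condition 1 p \<and> 2 \<notin> set p}"
    and "F \<equiv> (\<lambda>(i, j, k). let N = i + 2 * j + 3 * k in
          (var_x ^ (N + 1) * var_q ^ ((N + 1) * N div 2 + 2 * i + j ^ 2 + 2 * j + 4 * k + 1)
         + var_x ^ (N + 2) * var_q ^ ((N + 2) * (N + 1) div 2 + i + j ^ 2 + 2 * j + 4 * k + 1)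
         + var_x ^ N * var_q ^ (N * (N - 1) div 2 + 3 * i + j ^ 2 + 4 * j + 7 * k))
         / (qpoch var_q var_q i * qpoch (var_q ^ 2) (var_q ^ 2) j * qpoch (var_q ^ 3) (var_q ^ 3) k))"
  shows "(\<lambda>p. var_x ^ length p * var_q ^ sum_list p) summable_on P \<and>
         F summable_on UNIV \<and>
         (\<Sum>\<^sub>\<infinity>p\<in>P. var_x ^ length p * var_q ^ sum_list p) = (\<Sum>\<^sub>\<infinity>ijk\<in>UNIV. F ijk)"
proof -
  \<comment> \<open>Each numerator term is a summand of some \<open>H\<close> times a monomial: the
    surplus N or 2N + 1 of the triangular numbers is absorbed into the linear exponents.\<close>
  have F: "F t = var_x ^ (wt t + 1) * lift (fps_X ^ 1 * summand 3 4 7 t)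
      + var_x ^ (wt t + 2) * lift (fps_X ^ 2 * summand 3 6 10 t)
      + var_x ^ (wt t + 0) * lift (fps_X ^ 0 * summand 3 4 7 t)" for t
  proof -
    obtain i j k where t: "t = (i, j, k)"
      by (cases t)
    define N where "N = i + 2 * j + 3 * k"
    have N: "wt t = N"
      by (simp add: t wt_def N_def)
    have e1: "(N + 1) * N div 2 + 2 * i + j ^ 2 + 2 * j + 4 * k + 1 = 1 + expo 3 4 7 t"
      unfolding tri_shift t expo_def Let_def prod.case N_def[symmetric]
      by (simp add: N_def)
    have e2: "(N + 2) * (N + 1) div 2 + i + j ^ 2 + 2 * j + 4 * k + 1 = 2 + expo 3 6 10 t"
      unfolding tri_shift t expo_def Let_def prod.case N_def[symmetric]
      by (simp add: N_def)
    have e3: "N * (N - 1) div 2 + 3 * i + j ^ 2 + 4 * j + 7 * k = expo 3 4 7 t"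
      by (simp add: t expo_def N_def Let_def)
    have "F t = (var_x ^ (N + 1) * var_q ^ (1 + expo 3 4 7 t) +
        var_x ^ (N + 2) * var_q ^ (2 + expo 3 6 10 t) +
        var_x ^ N * var_q ^ expo 3 4 7 t) / lift (denom t)"
      unfolding e1[symmetric] e2[symmetric] unfolding e3[symmetric]
      by (simp only: F_def t denom_def prod.case Let_def N_def lift_mult lift_qpoch lift_power lift_X)
    then show ?thesis
      unfolding divide_lift[OF denom_nth_0] N
      by (simp add: summand_def power_add power2_eq_square algebra_simps)
  qed
  have P: "P = {p. good p \<and> 2 \<notin> set p}"
    by (auto simp: P_def good_def)
  \<comment> \<open>The trivial shift in the last term gives all three terms the form of
    \<open>has_sum_triple\<close>.\<close>
  define g where "g = (\<lambda>m. (if 1 \<le> m then fps_X ^ 1 * H 3 4 7 (m - 1) else 0)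
      + (if 2 \<le> m then fps_X ^ 2 * H 3 6 10 (m - 2) else 0)
      + (if 0 \<le> m then fps_X ^ 0 * H 3 4 7 (m - 0) else 0))"
  have F_sum: "(F has_sum swap g) UNIV"
    unfolding F g_def swap_add[symmetric]
    by (intro has_sum_fps_add has_sum_triple) simp_all
  have "pgf P = g"
  proof
    fix m
    \<comment> \<open>These are \<open>A(xq^2)\<close> and \<open>B(xq^2)\<close>, as they occur in
      \<open>pgf_without_2\<close>.\<close>
    have H: "H 3 4 7 n = fps_X ^ (2 * n) * H 1 0 1 n" "H 3 6 10 n = fps_X ^ (2 * n) * H 1 2 4 n" for n
      using H_shift[of 3 1 2 4 0 7 1 n] H_shift[of 3 1 2 6 2 10 4 n] by simp_all
    show "pgf P m = g m"
      unfolding P pgf_without_2 pgf_eq_H g_def H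
      by (simp only: power_add mult_ac add_ac diff_zero zero_le if_True power_0 mult_1_left mult_1_right)
  qed
  moreover have "((\<lambda>p. var_x ^ length p * var_q ^ sum_list p) has_sum swap (pgf P)) P"
    by (rule has_sum_partitions) (simp add: P_def)
  ultimately have "((\<lambda>p. var_x ^ length p * var_q ^ sum_list p) has_sum swap g) P"
    by simp
  with F_sum show ?thesis
    by (simp add: has_sum_imp_summable infsumI)
qed

end
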